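(* Let $G$ be an infinite finitely generated group along with a finite generating set $S$. Then $$h(X^g_{G,S})=\log(\mu^g(G,S)),$$ where $h(X^g_{G,S})$ is the topological entropy of the geodesic skeleton and $\mu^g(G,S)$ is the geodesic connective constant.
   Context: All generating sets $S$ are finite, symmetric ($S=S^{-1}$) and do not contain the identity. A word $w\in S^*$ is a geodesic if no shorter word over $S$ represents the same group element; $\mathrm{Geo}(G,S)$ is the set of geodesics. The geodesic skeleton $X^g_{G,S}$ is the set of $x\in S^{\mathbb{Z}}$ all of whose finite factors (contiguous subwords) are geodesics. For a subshift $X$, $p_X(n)$ is the number of words of length $n$ that are factors of some $x\in X$, and $h(X)=\lim_{n\to\infty}\frac1n\log p_X(n)$. The geodesic growth function is $\Gamma_{G,S}(n)=|\{w\in\mathrm{Geo}(G,S):|w|\le n\}|$ and $\mu^g(G,S)=\lim_{n\to\infty}\sqrt[n]{\Gamma_{G,S}(n)}$. *)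

theory Defs
  imports Complex_Main "HOL-Algebra.Generated_Groups"
begin

text \<open>
  A word over \<open>S\<close> is a list in \<^term>\<open>lists S\<close>; its letters are the group
  elements themselves.
\<close>

definition word_value :: "('a, 'b) monoid_scheme \<Rightarrow> 'a list \<Rightarrow> 'a" where
  "word_value G w = foldr (mult G) w (one G)"

definition geodesics :: "('a, 'b) monoid_scheme \<Rightarrow> 'a set \<Rightarrow> 'a list set" where
  "geodesics G S =
     {w \<in> lists S. \<not> (\<exists>v\<in>lists S. length v < length w \<and> word_value G v = word_value G w)}"

definition factor_at :: "(int \<Rightarrow> 'a) \<Rightarrow> int \<Rightarrow> nat \<Rightarrow> 'a list" where
  "factor_at x i n = map (\<lambda>k. x (i + int k)) [0..<n]"

definition geodesic_skeleton :: "('a, 'b) monoid_scheme \<Rightarrow> 'a set \<Rightarrow> (int \<Rightarrow> 'a) set" where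
  "geodesic_skeleton G S =
     {x. (\<forall>i. x i \<in> S) \<and> (\<forall>i n. factor_at x i n \<in> geodesics G S)}"

definition factor_complexity :: "(int \<Rightarrow> 'a) set \<Rightarrow> nat \<Rightarrow> nat" where
  "factor_complexity X n = card {w. length w = n \<and> (\<exists>x\<in>X. \<exists>i. w = factor_at x i n)}"

text \<open>
  The two limits below exist in the intended situation (nonempty subshifts over a finite alphabet,
  respectively finite symmetric generating sets of infinite groups) by submultiplicativity of the
  numbers of factors and of geodesics of length exactly \<open>n\<close>. The value at \<open>n = 0\<close>, where \<open>1 / 0 = 0\<close> and \<open>root 0 x = 0\<close>,
  is irrelevant to them.
\<close>

definition topological_entropy :: "(int \<Rightarrow> 'a) set \<Rightarrow> real" where
  "topological_entropy X = lim (\<lambda>n. 1 / real n * ln (real (factor_complexity X n)))"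

definition geodesic_growth :: "('a, 'b) monoid_scheme \<Rightarrow> 'a set \<Rightarrow> nat \<Rightarrow> nat" where
  "geodesic_growth G S n = card {w \<in> geodesics G S. length w \<le> n}"

definition geodesic_connective_constant :: "('a, 'b) monoid_scheme \<Rightarrow> 'a set \<Rightarrow> real" where
  "geodesic_connective_constant G S = lim (\<lambda>n. root n (real (geodesic_growth G S n)))"

end

theory Submission
  imports Defs "HOL-Real_Asymp.Real_Asymp"
begin

text \<open>
  Write \<open>p n\<close> for the number of factors of length \<open>n\<close> of the skeleton and \<open>g N\<close> for the number of
  geodesics of length \<open>N\<close>. By compactness, for fixed \<open>n\<close> there is \<open>m\<close> such that the words of length
  \<open>n\<close> that extend to a geodesic by \<open>m\<close> letters on both sides are exactly these factors. Cutting the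
  middle of a long geodesic into blocks of length \<open>n\<close> gives \<open>g N \<le> C * p n ^ (N div n)\<close> with \<open>C\<close>
  depending only on \<open>n\<close>. So for the geodesic growth function \<open>\<Gamma>\<close> one gets
  \<open>limsup (ln (\<Gamma> N) / N) \<le> ln (p n) / n \<le> ln (\<Gamma> n) / n\<close> for every \<open>n\<close>, which forces both quotients
  to converge to the same limit. Besides finiteness of \<open>S\<close>, only two properties of geodesics matter:
  they are closed under factors, and there are geodesics of every length.
\<close>

section \<open>A squeeze criterion for a common limit\<close>

text \<open>The limit is the infimum of \<open>b\<close> over positive indices: it bounds
  \<open>b\<close>, hence \<open>a\<close>, from below, and each fixed \<open>b n\<close> eventually
  bounds \<open>a\<close> from above up to \<open>e\<close>. Convergence is a conclusion here, which
  is what gives meaning to the \<open>lim\<close> terms later.\<close>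

lemma common_limit:
  fixes a b :: "nat \<Rightarrow> real"
  assumes nonneg: "\<And>n. 0 < n \<Longrightarrow> 0 \<le> b n"
    and le: "\<And>n. 0 < n \<Longrightarrow> b n \<le> a n"
    and limsup: "\<And>n e. 0 < n \<Longrightarrow> 0 < e \<Longrightarrow> eventually (\<lambda>N. a N \<le> b n + e) sequentially"
  obtains l where "a \<longlonglongrightarrow> l" and "b \<longlonglongrightarrow> l"
proof
  define l where "l = Inf (b ` {0<..})"
  have bdd: "bdd_below (b ` {0<..})"
    using nonneg by (intro bdd_belowI[of _ 0]) auto
  have lower: "l \<le> b n" if "0 < n" for n
    unfolding l_def using that by (intro cInf_lower bdd) auto
  have upper: "eventually (\<lambda>N. 0 < N \<and> a N < l + e) sequentially" if "0 < e" for e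
  proof -
    have "\<exists>y\<in>b ` {0<..}. y < l + e / 2"
      unfolding l_def using that cInf_lessD[of "b ` {0<..}" "Inf (b ` {0<..}) + e / 2"] by auto
    then obtain n where n: "0 < n" "b n < l + e / 2" by auto
    have "eventually (\<lambda>N. a N \<le> b n + e / 2) sequentially"
      using limsup[OF n(1), of "e / 2"] that by simp
    with eventually_gt_at_top[of 0] show ?thesis
      by eventually_elim (use n in linarith)
  qed
  show "a \<longlonglongrightarrow> l"
  proof (rule tendstoI)
    fix e :: real assume "0 < e"
    from upper[OF this] show "eventually (\<lambda>N. dist (a N) l < e) sequentially"
    proof eventually_elim
      case (elim N)
      then show ?case using lower[of N] le[of N] by (auto simp: dist_real_def)
    qed
  qed
  show "b \<longlonglongrightarrow> l"
  proof (rule tendstoI)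
    fix e :: real assume "0 < e"
    from upper[OF this] show "eventually (\<lambda>N. dist (b N) l < e) sequentially"
    proof eventually_elim
      case (elim N)
      then show ?case using lower[of N] le[of N] by (auto simp: dist_real_def)
    qed
  qed
qed

section \<open>Factors of bi-infinite words\<close>

lemma length_factor_at [simp]: "length (factor_at x i n) = n"
  by (simp add: factor_at_def)

lemma factor_at_add: "factor_at x i (m + n) = factor_at x i m @ factor_at x (i + int m) n"
proof -
  have "map (\<lambda>k. x (i + int k)) [m..<m + n] = map (\<lambda>k. x (i + int m + int k)) [0..<n]"
    by (rule nth_equalityI) (auto simp: algebra_simps)
  then show ?thesis
    unfolding factor_at_def upt_add_eq_append[OF le0] map_append by simp
qed

definition skeleton :: "'a list set \<Rightarrow> (int \<Rightarrow> 'a) set" where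
  "skeleton L = {x. \<forall>i n. factor_at x i n \<in> L}"

section \<open>Factorial languages and two-sided extension\<close>

locale factorial_language =
  fixes S :: "'a set" and L :: "'a list set"
  assumes finite_alphabet: "finite S"
    and words: "L \<subseteq> lists S"
    and factor_closed: "u @ w @ v \<in> L \<Longrightarrow> w \<in> L"
    and all_lengths: "\<exists>w\<in>L. length w = n"
begin

text \<open>A finite approximation to occurring in a bi-infinite word. Padding both sides by the
  same length makes it a condition that only gets stronger as \<open>m\<close> grows.\<close>

definition extendable :: "nat \<Rightarrow> 'a list \<Rightarrow> bool" where
  "extendable m w \<longleftrightarrow> (\<exists>u v. length u = m \<and> length v = m \<and> u @ w @ v \<in> L)"

definition ext_words :: "nat \<Rightarrow> nat \<Rightarrow> 'a list set" where
  "ext_words m n = {w. length w = n \<and> extendable m w}"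

lemma extendable_antimono:
  assumes "extendable m w" "k \<le> m"
  shows "extendable k w"
proof -
  from assms(1) obtain u v where uv: "length u = m" "length v = m" "u @ w @ v \<in> L"
    unfolding extendable_def by auto
  have "take (m - k) u @ (drop (m - k) u @ w @ take k v) @ drop k v \<in> L"
    using uv(3) by (metis append.assoc append_take_drop_id)
  then have "drop (m - k) u @ w @ take k v \<in> L" by (rule factor_closed)
  moreover have "length (drop (m - k) u) = k" "length (take k v) = k" using uv assms(2) by auto
  ultimately show ?thesis unfolding extendable_def by blast
qed

lemma extendable_in_L: "extendable m w \<Longrightarrow> w \<in> L"
  unfolding extendable_def using factor_closed by blast

text \<open>The context of \<open>w\<close> becomes \<open>u @ a\<close> and \<open>b @ v\<close>,
  which is at least \<open>m\<close> letters on each side; trimming the outer ends leaves exactly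
  \<open>m\<close>.\<close>

lemma extendable_factor:
  assumes "extendable m (a @ w @ b)"
  shows "extendable m w"
proof -
  from assms obtain u v where uv: "length u = m" "length v = m" "u @ (a @ w @ b) @ v \<in> L"
    unfolding extendable_def by auto
  let ?u = "u @ a" and ?v = "b @ v"
  have "take (length a) ?u @ (drop (length a) ?u @ w @ take m ?v) @ drop m ?v = u @ (a @ w @ b) @ v"
    by (metis append.assoc append_take_drop_id)
  with uv(3) have "drop (length a) ?u @ w @ take m ?v \<in> L"
    using factor_closed by metis
  moreover have "length (drop (length a) ?u) = m" "length (take m ?v) = m"
    using uv by auto
  ultimately show ?thesis unfolding extendable_def by blast
qed

lemma letters_in_alphabet: "u @ w @ v \<in> L \<Longrightarrow> set u \<union> set w \<union> set v \<subseteq> S"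
  using words by (fastforce simp: in_lists_conv_set)

text \<open>The pigeonhole step of Koenig's lemma: each \<open>m\<close> yields a pair of letters,
  some pair recurs for infinitely many \<open>m\<close>, and antimonotonicity then gives all
  \<open>m\<close>.\<close>

lemma extendable_step:
  assumes "\<And>m. extendable m w"
  shows "\<exists>a b. \<forall>m. extendable m (a # w @ [b])"
proof -
  have "\<exists>a\<in>S. \<exists>b\<in>S. extendable m (a # w @ [b])" for m
  proof -
    \<comment> \<open>One letter of padding on each side is absorbed into the word, leaving
      \<open>m\<close>.\<close>
    obtain u v where uv: "length u = Suc m" "length v = Suc m" "u @ w @ v \<in> L"
      using assms[of "Suc m"] unfolding extendable_def by auto
    obtain u' a where u: "u = u' @ [a]" using uv(1) by (cases u rule: rev_cases) auto
    obtain b v' where v: "v = b # v'" using uv(2) by (cases v) auto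
    have "u' @ (a # w @ [b]) @ v' \<in> L" using uv u v by simp
    moreover have "a \<in> S" "b \<in> S" using letters_in_alphabet[OF uv(3)] u v by auto
    ultimately show ?thesis using uv u v unfolding extendable_def by fastforce
  qed
  then obtain a b where ab: "\<And>m. a m \<in> S" "\<And>m. b m \<in> S" "\<And>m. extendable m (a m # w @ [b m])"
    by metis
  have "range (\<lambda>m. (a m, b m)) \<subseteq> S \<times> S" using ab by auto
  then have "finite (range (\<lambda>m. (a m, b m)))"
    using finite_alphabet by (meson finite_SigmaI finite_subset)
  then obtain k where inf: "infinite {m. (a m, b m) = (a k, b k)}"
    using pigeonhole_infinite[of "UNIV :: nat set" "\<lambda>m. (a m, b m)"] by auto
  have "extendable m (a k # w @ [b k])" for m
  proof -
    obtain j where "j \<ge> m" "(a j, b j) = (a k, b k)"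
      using inf unfolding finite_nat_set_iff_bounded_le by (auto simp: not_le intro: less_imp_le)
    with ab(3)[of j] show ?thesis using extendable_antimono by auto
  qed
  then show ?thesis by blast
qed

section \<open>Compactness\<close>

text \<open>Iterating the one-letter extension yields nested words \<open>W k\<close> around
  \<open>w\<close>, whose union is a bi-infinite word. Each of its factors lies in some
  \<open>W k\<close>, hence in \<open>L\<close>.\<close>

lemma extendable_imp_skeleton_factor:
  assumes w: "\<And>m. extendable m w"
  shows "\<exists>x\<in>skeleton L. w = factor_at x 0 (length w)"
proof -
  \<comment> \<open>The premise sits below the existential so that choice gives a total function
    \<open>f\<close> that can be iterated.\<close>
  have "\<forall>v. \<exists>v'. (\<forall>m. extendable m v) \<longrightarrow> (\<forall>m. extendable m v') \<and> (\<exists>a b. v' = a # v @ [b])"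
    using extendable_step by blast
  then obtain f where f: "\<And>v. (\<forall>m. extendable m v) \<Longrightarrow>
      (\<forall>m. extendable m (f v)) \<and> (\<exists>a b. f v = a # v @ [b])"
    by metis
  define W where "W k = (f ^^ k) w" for k
  have W0: "W 0 = w" by (simp add: W_def)
  have all_ext: "\<forall>m. extendable m (W k)" for k
    by (induction k) (use w f in \<open>auto simp: W_def\<close>)
  then have Wext: "extendable m (W k)" for k m by blast
  have WSuc: "\<exists>a b. W (Suc k) = a # W k @ [b]" for k
    using f[OF all_ext[of k]] by (simp add: W_def)
  have len: "length (W k) = length w + 2 * k" for k
  proof (induction k)
    case (Suc k)
    then show ?case using WSuc[of k] by auto
  qed (simp add: W0)
  \<comment> \<open>Each extension prepends one letter, so old indices move up by one.\<close>
  have shift: "W (k + j) ! (i + j) = W k ! i" if "i < length (W k)" for i j k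
  proof (induction j)
    case (Suc j)
    obtain a b where "W (Suc (k + j)) = a # W (k + j) @ [b]" using WSuc by blast
    moreover have "i + j < length (W (k + j))" using that len by simp
    ultimately show ?case using Suc by (simp add: nth_append)
  qed simp
  \<comment> \<open>The origin of \<open>x\<close> sits at index \<open>k\<close> of
    \<open>W k\<close>, where \<open>w\<close> begins. The \<open>Suc\<close> keeps the index in
    range for \<open>i \<ge> 0\<close> even when \<open>w\<close> is empty.\<close>
  define x where "x i = W (Suc (nat \<bar>i\<bar>)) ! nat (i + int (Suc (nat \<bar>i\<bar>)))" for i
  have x_eq: "x i = W k ! nat (i + int k)" if "nat \<bar>i\<bar> < k" for i k
  proof -
    define j where "j = k - Suc (nat \<bar>i\<bar>)"
    have k: "k = Suc (nat \<bar>i\<bar>) + j" using that j_def by simp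
    have "nat (i + int k) = nat (i + int (Suc (nat \<bar>i\<bar>))) + j"
      using k by linarith
    moreover have "nat (i + int (Suc (nat \<bar>i\<bar>))) < length (W (Suc (nat \<bar>i\<bar>)))"
      unfolding len by (cases "0 \<le> i") auto
    ultimately show ?thesis
      unfolding x_def k using shift by presburger
  qed
  have "factor_at x i n \<in> L" for i n
  proof -
    \<comment> \<open>Large enough that every position of the window has absolute value below
      \<open>k\<close>, so a single \<open>W k\<close> contains the whole factor.\<close>
    define k where "k = Suc (nat \<bar>i\<bar> + n)"
    define j where "j = nat (i + int k)"
    have bound: "j + n \<le> length (W k)" unfolding j_def len k_def by (cases "0 \<le> i") auto
    have "factor_at x i n = take n (drop j (W k))"
    proof (rule nth_equalityI)
      show "length (factor_at x i n) = length (take n (drop j (W k)))" using bound by simp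
      fix q assume "q < length (factor_at x i n)"
      then have q: "q < n" by simp
      have "x (i + int q) = W k ! nat (i + int q + int k)"
        by (rule x_eq) (use q in \<open>simp add: k_def\<close>)
      moreover have "nat (i + int q + int k) = j + q" unfolding j_def k_def by linarith
      ultimately show "factor_at x i n ! q = take n (drop j (W k)) ! q"
        using q bound by (simp add: factor_at_def)
    qed
    moreover have "take j (W k) @ take n (drop j (W k)) @ drop n (drop j (W k)) = W k"
      by (simp only: append_take_drop_id)
    ultimately show ?thesis using factor_closed extendable_in_L[OF Wext] by metis
  qed
  moreover have "w = factor_at x 0 (length w)"
  proof (rule nth_equalityI)
    fix q assume q: "q < length w"
    have "x (int q) = W (Suc q) ! nat (int q + int (Suc q))" by (rule x_eq) simp
    also have "nat (int q + int (Suc q)) = q + Suc q" by linarith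
    also have "W (Suc q) ! (q + Suc q) = w ! q" using shift[of q 0 "Suc q"] q W0 by simp
    finally show "w ! q = factor_at x 0 (length w) ! q" using q by (simp add: factor_at_def)
  qed simp
  ultimately show ?thesis unfolding skeleton_def by blast
qed

lemma skeleton_factor_extendable:
  assumes "x \<in> skeleton L"
  shows "extendable m (factor_at x i n)"
proof -
  \<comment> \<open>Starting \<open>m\<close> places earlier and ending \<open>m\<close> places
    later supplies both paddings.\<close>
  have "factor_at x (i - int m) (m + (n + m)) \<in> L" using assms by (simp add: skeleton_def)
  then show ?thesis unfolding extendable_def factor_at_add[of x "i - int m"]
    by (simp add: factor_at_add) (metis length_factor_at)
qed

lemma skeleton_factors_eq:
  "{w. length w = n \<and> (\<exists>x\<in>skeleton L. \<exists>i. w = factor_at x i n)} = {w. length w = n \<and> (\<forall>m. extendable m w)}"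
proof (intro Collect_cong conj_cong refl iffI)
  fix w assume "\<exists>x\<in>skeleton L. \<exists>i. w = factor_at x i n"
  then show "\<forall>m. extendable m w" using skeleton_factor_extendable by auto
next
  fix w :: "'a list" assume n: "length w = n" and "\<forall>m. extendable m w"
  then obtain x where "x \<in> skeleton L" "w = factor_at x 0 (length w)"
    using extendable_imp_skeleton_factor by blast
  then show "\<exists>x\<in>skeleton L. \<exists>i. w = factor_at x i n" unfolding n by blast
qed

lemma finite_words: "finite {w. set w \<subseteq> S \<and> length w = n}"
  using finite_lists_length_eq[OF finite_alphabet] .

lemma L_subset_words: "{w \<in> L. length w = n} \<subseteq> {w. set w \<subseteq> S \<and> length w = n}"
  using words by (auto simp: in_lists_conv_set)

lemma ext_words_subset: "ext_words m n \<subseteq> {w \<in> L. length w = n}"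
  unfolding ext_words_def using extendable_in_L by blast

lemma finite_L_length: "finite {w \<in> L. length w = n}"
  using finite_subset[OF L_subset_words finite_words] .

lemma finite_ext_words: "finite (ext_words m n)"
  using finite_subset[OF ext_words_subset finite_L_length] .

text \<open>Only finitely many words of length \<open>n\<close> lie in \<open>L\<close>. Each one
  that is not extendable forever fails from some padding on, and the maximum of these paddings works
  for all of them.\<close>

lemma skeleton_factors_eq_ext_words:
  "\<exists>m. {w. length w = n \<and> (\<exists>x\<in>skeleton L. \<exists>i. w = factor_at x i n)} = ext_words m n"
proof -
  have "\<exists>m. \<forall>w\<in>A. (\<exists>k. \<not> extendable k w) \<longrightarrow> \<not> extendable m w" if "finite A" for A
    using that
  proof induction
    case (insert w A)
    then obtain m where m: "\<forall>w\<in>A. (\<exists>k. \<not> extendable k w) \<longrightarrow> \<not> extendable m w" by blast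
    show ?case
    proof (cases "\<exists>k. \<not> extendable k w")
      case True
      then obtain k where "\<not> extendable k w" by blast
      then show ?thesis using m extendable_antimono
        by (intro exI[of _ "max m k"]) (metis insert_iff max.cobounded1 max.cobounded2)
    qed (use m in blast)
  qed simp
  then obtain m where "\<forall>w\<in>{w \<in> L. length w = n}. (\<exists>k. \<not> extendable k w) \<longrightarrow> \<not> extendable m w"
    using finite_L_length by blast
  then have "(\<forall>m. extendable m w) \<longleftrightarrow> extendable m w" if "length w = n" for w
    using that extendable_in_L[of m w] by auto
  then have "{w. length w = n \<and> (\<forall>m. extendable m w)} = ext_words m n"
    unfolding ext_words_def by (intro Collect_cong conj_cong refl)
  then show ?thesis unfolding skeleton_factors_eq by (rule exI)
qed

section \<open>Counting words by blocks\<close>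

lemma ext_words_nonempty: "ext_words m n \<noteq> {}"
proof -
  obtain w where w: "w \<in> L" "length w = m + n + m" using all_lengths by blast
  have "w = take m w @ take n (drop m w) @ drop n (drop m w)"
    by (simp only: append_take_drop_id)
  with w have "extendable m (take n (drop m w))"
    unfolding extendable_def
    by (intro exI[of _ "take m w"] exI[of _ "drop n (drop m w)"]) simp
  moreover have "length (take n (drop m w)) = n" using w by simp
  ultimately show ?thesis unfolding ext_words_def by blast
qed

text \<open>Splitting a word keeps the padding \<open>m\<close> for both pieces, since each piece is
  a factor of an \<open>m\<close>-extendable word; so submultiplicativity holds with
  \<open>m\<close> fixed.\<close>

lemma card_ext_words_add: "card (ext_words m (a + b)) \<le> card (ext_words m a) * card (ext_words m b)"
proof -
  have "ext_words m (a + b) \<subseteq> (\<lambda>(u, v). u @ v) ` (ext_words m a \<times> ext_words m b)"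
  proof
    fix w assume w: "w \<in> ext_words m (a + b)"
    have "extendable m (take a w)" "extendable m (drop a w)"
      using w extendable_factor[of m "[]" "take a w" "drop a w"]
        extendable_factor[of m "take a w" "drop a w" "[]"] by (auto simp: ext_words_def)
    then have "(take a w, drop a w) \<in> ext_words m a \<times> ext_words m b"
      using w by (auto simp: ext_words_def)
    then show "w \<in> (\<lambda>(u, v). u @ v) ` (ext_words m a \<times> ext_words m b)"
      by (intro image_eqI[of _ _ "(take a w, drop a w)"]) auto
  qed
  then have "card (ext_words m (a + b)) \<le> card (ext_words m a \<times> ext_words m b)"
    by (meson finite_SigmaI finite_ext_words surj_card_le)
  then show ?thesis by (simp add: card_cartesian_product)
qed

lemma card_ext_words_power: "card (ext_words m (k * n + r)) \<le> card (ext_words m n) ^ k * card (ext_words m r)"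
proof (induction k)
  case (Suc k)
  have "card (ext_words m (Suc k * n + r)) \<le> card (ext_words m n) * card (ext_words m (k * n + r))"
    using card_ext_words_add[of m n "k * n + r"] by (simp add: add.assoc)
  also have "\<dots> \<le> card (ext_words m n) * (card (ext_words m n) ^ k * card (ext_words m r))"
    using Suc by (rule mult_left_mono) simp
  finally show ?case by (simp add: mult.assoc)
qed simp

lemma card_L_length_le: "card {w \<in> L. length w = n} \<le> card S ^ n"
  using card_mono[OF finite_words L_subset_words] card_lists_length_eq[OF finite_alphabet] by simp

lemma card_alphabet_pos: "card S \<ge> 1"
proof -
  obtain w where "w \<in> L" "length w = 1" using all_lengths by blast
  then have "hd w \<in> S" using words by (cases w) (auto simp: in_lists_conv_set)
  then show ?thesis using finite_alphabet by (metis One_nat_def Suc_leI card_gt_0_iff empty_iff)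
qed

text \<open>The middle \<open>N\<close> letters of such a word are \<open>m\<close>-extendable,
  while the two ends are arbitrary words over \<open>S\<close>.\<close>

lemma card_L_le_ext_words:
  "card {w \<in> L. length w = m + N + m} \<le> card S ^ (2 * m) * card (ext_words m N)"
proof -
  let ?W = "{w. set w \<subseteq> S \<and> length w = m}"
  have "{w \<in> L. length w = m + N + m} \<subseteq> (\<lambda>(u, w, v). u @ w @ v) ` (?W \<times> ext_words m N \<times> ?W)"
  proof
    fix w assume w: "w \<in> {w \<in> L. length w = m + N + m}"
    let ?u = "take m w" and ?w = "take N (drop m w)" and ?v = "drop N (drop m w)"
    have eq: "w = ?u @ ?w @ ?v" by (simp only: append_take_drop_id)
    have len: "length ?u = m" "length ?v = m" "length ?w = N" using w by auto
    have L: "?u @ ?w @ ?v \<in> L" using w eq by simp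
    then have "?w \<in> ext_words m N"
      unfolding ext_words_def extendable_def using len by blast
    moreover have "?u \<in> ?W" "?v \<in> ?W" using letters_in_alphabet[OF L] len by blast+
    ultimately have "(?u, ?w, ?v) \<in> ?W \<times> ext_words m N \<times> ?W" by blast
    then show "w \<in> (\<lambda>(u, w, v). u @ w @ v) ` (?W \<times> ext_words m N \<times> ?W)"
      by (rule rev_image_eqI) (simp only: prod.case append_take_drop_id)
  qed
  then have "card {w \<in> L. length w = m + N + m} \<le> card (?W \<times> ext_words m N \<times> ?W)"
    by (intro surj_card_le finite_SigmaI finite_ext_words finite_words)
  also have "\<dots> = card S ^ (2 * m) * card (ext_words m N)"
    by (simp add: card_cartesian_product card_lists_length_eq[OF finite_alphabet]
        mult_2 power_add)
  finally show ?thesis .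
qed

lemma factor_complexity_pos: "1 \<le> factor_complexity (skeleton L) n"
proof -
  obtain m where m: "factor_complexity (skeleton L) n = card (ext_words m n)"
    using skeleton_factors_eq_ext_words unfolding factor_complexity_def by metis
  show ?thesis unfolding m using ext_words_nonempty finite_ext_words
    by (simp add: Suc_le_eq card_gt_0_iff)
qed

text \<open>The padding \<open>m\<close> depends only on \<open>n\<close>, so the cost of discarding
  both ends and the incomplete last block is a constant independent of \<open>N\<close>.\<close>

lemma card_L_length_bound:
  assumes "0 < n"
  shows "\<exists>C\<ge>1. \<forall>N. card {w \<in> L. length w = N} \<le> C * factor_complexity (skeleton L) n ^ (N div n)"
proof -
  let ?p = "factor_complexity (skeleton L) n"
  obtain m where m: "?p = card (ext_words m n)"
    using skeleton_factors_eq_ext_words unfolding factor_complexity_def by metis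
  \<comment> \<open>The \<open>2 * m\<close> pays for the two ends, the \<open>n\<close> for a
    remainder of fewer than \<open>n\<close> letters. Words shorter than \<open>2 * m\<close> are
    also covered by this constant.\<close>
  define C where "C = card S ^ (2 * m + n)"
  have "card {w \<in> L. length w = N} \<le> C * ?p ^ (N div n)" for N
  proof (cases "N < 2 * m")
    case True
    have "card {w \<in> L. length w = N} \<le> card S ^ N" by (rule card_L_length_le)
    also have "\<dots> \<le> C" unfolding C_def using True card_alphabet_pos by (intro power_increasing) auto
    also have "\<dots> \<le> C * ?p ^ (N div n)" using factor_complexity_pos by simp
    finally show ?thesis .
  next
    case False
    define K where "K = N - 2 * m"
    have N: "N = m + K + m" using False K_def by simp
    have "card (ext_words m K) \<le> ?p ^ (K div n) * card (ext_words m (K mod n))"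
      using card_ext_words_power[of m "K div n" n "K mod n"] m by simp
    also have "card (ext_words m (K mod n)) \<le> card S ^ (K mod n)"
      using card_mono[OF finite_L_length ext_words_subset] card_L_length_le le_trans by blast
    also have "\<dots> \<le> card S ^ n"
      using assms card_alphabet_pos by (intro power_increasing) (auto simp: less_imp_le)
    also have "?p ^ (K div n) \<le> ?p ^ (N div n)"
      using factor_complexity_pos N by (intro power_increasing div_le_mono) auto
    finally have "card (ext_words m K) \<le> ?p ^ (N div n) * card S ^ n" by simp
    then have "card S ^ (2 * m) * card (ext_words m K) \<le> card S ^ (2 * m) * (?p ^ (N div n) * card S ^ n)"
      by simp
    with card_L_le_ext_words[of m K] show ?thesis
      unfolding N[symmetric] C_def power_add by (simp only: ac_simps order_trans)
  qed
  moreover have "C \<ge> 1" unfolding C_def using card_alphabet_pos by (rule one_le_power)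
  ultimately show ?thesis by blast
qed

section \<open>Growth rate and entropy\<close>

lemma growth_eq_UN: "{w \<in> L. length w \<le> N} = (\<Union>k\<le>N. {w \<in> L. length w = k})"
  by auto

lemma factor_complexity_le_growth:
  "factor_complexity (skeleton L) n \<le> card {w \<in> L. length w \<le> n}"
  unfolding factor_complexity_def
proof (rule card_mono)
  show "finite {w \<in> L. length w \<le> n}" unfolding growth_eq_UN using finite_L_length by blast
  show "{w. length w = n \<and> (\<exists>x\<in>skeleton L. \<exists>i. w = factor_at x i n)} \<subseteq> {w \<in> L. length w \<le> n}"
    unfolding skeleton_factors_eq using extendable_in_L by auto
qed

lemma growth_bound:
  assumes "0 < n"
  shows "\<exists>C\<ge>1. \<forall>N. card {w \<in> L. length w \<le> N} \<le> Suc N * (C * factor_complexity (skeleton L) n ^ (N div n))"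
proof -
  let ?p = "factor_complexity (skeleton L) n"
  obtain C where C: "C \<ge> 1" "\<And>N. card {w \<in> L. length w = N} \<le> C * ?p ^ (N div n)"
    using card_L_length_bound[OF assms] by blast
  have "card {w \<in> L. length w \<le> N} \<le> Suc N * (C * ?p ^ (N div n))" for N
  proof -
    have "card {w \<in> L. length w \<le> N} \<le> (\<Sum>k\<le>N. card {w \<in> L. length w = k})"
      unfolding growth_eq_UN by (rule card_UN_le) simp
    also have "\<dots> \<le> (\<Sum>k\<le>N. C * ?p ^ (N div n))"
    proof (rule sum_mono)
      fix k assume "k \<in> {..N}"
      then have "?p ^ (k div n) \<le> ?p ^ (N div n)"
        using factor_complexity_pos by (intro power_increasing div_le_mono) auto
      then show "card {w \<in> L. length w = k} \<le> C * ?p ^ (N div n)"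
        using C(2)[of k] by (meson le_trans mult_le_mono2)
    qed
    finally show ?thesis by simp
  qed
  with C(1) show ?thesis by blast
qed

lemma entropy_eq_growth_rate:
  "topological_entropy (skeleton L) = ln (lim (\<lambda>n. root n (real (card {w \<in> L. length w \<le> n}))))"
proof -
  let ?p = "\<lambda>n. real (factor_complexity (skeleton L) n)"
  let ?g = "\<lambda>n. real (card {w \<in> L. length w \<le> n})"
  have p1: "1 \<le> ?p n" for n using factor_complexity_pos by (simp add: Suc_le_eq)
  have pg: "?p n \<le> ?g n" for n using factor_complexity_le_growth by simp
  have g1: "1 \<le> ?g n" for n using p1[of n] pg[of n] by linarith
  obtain l where l: "(\<lambda>n. 1 / real n * ln (?g n)) \<longlonglongrightarrow> l" "(\<lambda>n. 1 / real n * ln (?p n)) \<longlonglongrightarrow> l"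
  \<comment> \<open>The factor complexity plays the role of \<open>b\<close>, the growth function
    that of \<open>a\<close>.\<close>
  proof (rule common_limit[of "\<lambda>n. 1 / real n * ln (?p n)" "\<lambda>n. 1 / real n * ln (?g n)"])
    show "0 \<le> 1 / real n * ln (?p n)" if "0 < n" for n using p1[of n] by simp
    show "1 / real n * ln (?p n) \<le> 1 / real n * ln (?g n)" if "0 < n" for n
      using p1[of n] pg[of n] g1[of n] by (intro mult_left_mono) (auto intro: ln_mono)
    show "eventually (\<lambda>N. 1 / real N * ln (?g N) \<le> 1 / real n * ln (?p n) + e) sequentially"
      if n: "0 < n" and e: "0 < e" for n e
    proof -
      obtain C where C: "C \<ge> 1"
        "\<And>N. card {w \<in> L. length w \<le> N} \<le> Suc N * (C * factor_complexity (skeleton L) n ^ (N div n))"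
        using growth_bound[OF n] by blast
      \<comment> \<open>This is what the factor \<open>Suc N * C\<close> contributes after taking
        logarithms and dividing by \<open>N\<close>.\<close>
      have "(\<lambda>N. ln (real N + 1) / real N + ln (real C) / real N) \<longlonglongrightarrow> 0"
        by real_asymp
      then have "eventually (\<lambda>N. ln (real N + 1) / real N + ln (real C) / real N < e) sequentially"
        using e by (rule order_tendstoD)
      with eventually_gt_at_top[of 0] show ?thesis
      proof eventually_elim
        case (elim N)
        have "?g N \<le> real (Suc N * (C * factor_complexity (skeleton L) n ^ (N div n)))"
          using C(2) of_nat_mono by blast
        then have "?g N \<le> (real N + 1) * (real C * ?p n ^ (N div n))" by (simp add: algebra_simps)
        then have "ln (?g N) \<le> ln ((real N + 1) * (real C * ?p n ^ (N div n)))"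
          using g1[of N] by (intro ln_mono) linarith+
        also have "\<dots> = ln (real N + 1) + ln (real C) + real (N div n) * ln (?p n)"
          using C(1) p1[of n] by (simp add: ln_mult ln_realpow)
        \<comment> \<open>Rounding may be dropped because \<open>ln (?p n)\<close> is
          nonnegative.\<close>
        also have "real (N div n) * ln (?p n) \<le> real N / real n * ln (?p n)"
          using p1[of n] by (intro mult_right_mono of_nat_div_le_of_nat) auto
        finally have "ln (?g N) \<le> ln (real N + 1) + ln (real C) + real N / real n * ln (?p n)"
          by simp
        then have "1 / real N * ln (?g N)
            \<le> 1 / real N * (ln (real N + 1) + ln (real C) + real N / real n * ln (?p n))"
          by (rule mult_left_mono) simp
        also have "\<dots> = ln (real N + 1) / real N + ln (real C) / real N + 1 / real n * ln (?p n)"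
          using elim n by (simp add: field_simps)
        finally show ?case using elim by linarith
      qed
    qed
  qed
  have exp_lim: "(\<lambda>n. exp (1 / real n * ln (?g n))) \<longlonglongrightarrow> exp l" using l(1) by (rule tendsto_exp)
  \<comment> \<open>The equality fails at \<open>n = 0\<close>, where the sides are \<open>1\<close>
    and \<open>0\<close> by the conventions for division and \<open>root\<close>.\<close>
  have "eventually (\<lambda>n. exp (1 / real n * ln (?g n)) = root n (?g n)) sequentially"
    using eventually_gt_at_top[of 0]
  proof eventually_elim
    case (elim n)
    then show ?case using g1[of n] by (simp add: root_powr_inverse powr_def)
  qed
  with exp_lim have "(\<lambda>n. root n (?g n)) \<longlonglongrightarrow> exp l" by (rule Lim_transform_eventually)
  then have "lim (\<lambda>n. root n (?g n)) = exp l" by (rule limI)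
  moreover have "topological_entropy (skeleton L) = l"
    unfolding topological_entropy_def using l(2) by (rule limI)
  ultimately show ?thesis by simp
qed

end

section \<open>Geodesic words in groups\<close>

context group
begin

lemma word_value_closed: "set w \<subseteq> carrier G \<Longrightarrow> word_value G w \<in> carrier G"
  by (induction w) (auto simp: word_value_def)

lemma word_value_append:
  "set u \<subseteq> carrier G \<Longrightarrow> set v \<subseteq> carrier G \<Longrightarrow> word_value G (u @ v) = word_value G u \<otimes> word_value G v"
proof (induction u)
  case Nil
  then show ?case using word_value_closed[of v] by (simp add: word_value_def)
next
  case (Cons a u)
  then show ?case using word_value_closed[of v] word_value_closed[of u]
    by (auto simp: word_value_def m_assoc)
qed

text \<open>A shorter word for \<open>w\<close>, spliced between \<open>u\<close> and
  \<open>v\<close>, would shorten the whole geodesic.\<close>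

lemma geodesics_factor_closed:
  assumes S: "S \<subseteq> carrier G" and geo: "u @ w @ v \<in> geodesics G S"
  shows "w \<in> geodesics G S"
proof -
  have sets: "set u \<subseteq> S" "set w \<subseteq> S" "set v \<subseteq> S"
    using geo by (auto simp: geodesics_def in_lists_conv_set)
  have False if w': "set w' \<subseteq> S" "length w' < length w" "word_value G w' = word_value G w" for w'
  proof -
    have "set u \<subseteq> carrier G" "set v \<subseteq> carrier G" "set w \<subseteq> carrier G" "set w' \<subseteq> carrier G"
      using sets w'(1) S by auto
    then have "word_value G (u @ w' @ v) = word_value G (u @ w @ v)"
      using w'(3) by (simp add: word_value_append)
    moreover have "u @ w' @ v \<in> lists S" using sets w' by (auto simp: in_lists_conv_set)
    ultimately show False using geo w'(2) by (auto simp: geodesics_def)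
  qed
  then show ?thesis using sets by (auto simp: geodesics_def in_lists_conv_set) (metis subsetI)
qed

text \<open>Symmetry of \<open>S\<close> turns the inverse rule of \<open>generate\<close> into a
  single letter, so products of letters reach the whole generated subgroup.\<close>

lemma generate_word_value:
  assumes S: "S \<subseteq> carrier G" and sym: "m_inv G ` S = S" and "g \<in> generate G S"
  shows "\<exists>w\<in>lists S. word_value G w = g"
  using assms(3)
proof induction
  case one
  show ?case by (intro bexI[of _ "[]"]) (auto simp: word_value_def)
next
  case (incl h)
  then show ?case using S by (intro bexI[of _ "[h]"]) (auto simp: word_value_def)
next
  case (inv h)
  then have "inv h \<in> S" using sym by blast
  then show ?case using S by (intro bexI[of _ "[inv h]"]) (auto simp: word_value_def)
next
  case (eng g h)
  then obtain u v where uv: "u \<in> lists S" "v \<in> lists S" "word_value G u = g" "word_value G v = h"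
    by blast
  then have "set u \<subseteq> carrier G" "set v \<subseteq> carrier G" using S by auto
  then have "word_value G (u @ v) = g \<otimes> h" using uv by (simp add: word_value_append)
  then show ?case using uv by (intro bexI[of _ "u @ v"]) auto
qed

lemma generate_geodesic:
  assumes "S \<subseteq> carrier G" "m_inv G ` S = S" "g \<in> generate G S"
  shows "\<exists>w\<in>geodesics G S. word_value G w = g"
proof -
  let ?P = "\<lambda>w. w \<in> lists S \<and> word_value G w = g"
  obtain w0 where "?P w0" using generate_word_value[OF assms] by blast
  then obtain w where w: "?P w" "\<forall>v. ?P v \<longrightarrow> length w \<le> length v"
    using ex_has_least_nat[of ?P w0 length] by blast
  then have "w \<in> geodesics G S" by (force simp: geodesics_def not_less)
  then show ?thesis using w by blast
qed

text \<open>If length \<open>n\<close> were missed, closure under prefixes would bound all geodesics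
  by \<open>n\<close>. Over a finite alphabet there would be finitely many, yet they represent every
  element of an infinite group.\<close>

lemma geodesic_of_length:
  assumes inf: "infinite (carrier G)" and fin: "finite S" and S: "S \<subseteq> carrier G"
    and sym: "m_inv G ` S = S" and gen: "generate G S = carrier G"
  shows "\<exists>w\<in>geodesics G S. length w = n"
proof (rule ccontr)
  assume none: "\<not> (\<exists>w\<in>geodesics G S. length w = n)"
  have short: "length w \<le> n" if "w \<in> geodesics G S" for w
  proof (rule ccontr)
    assume "\<not> length w \<le> n"
    moreover have "[] @ take n w @ drop n w \<in> geodesics G S" using that by simp
    then have "take n w \<in> geodesics G S" by (rule geodesics_factor_closed[OF S])
    ultimately show False using none by auto
  qed
  have "geodesics G S \<subseteq> {w. set w \<subseteq> S \<and> length w \<le> n}"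
    using short by (auto simp: geodesics_def in_lists_conv_set)
  then have "finite (geodesics G S)" using finite_lists_length_le[OF fin] finite_subset by blast
  moreover have "carrier G \<subseteq> word_value G ` geodesics G S"
    using generate_geodesic[OF S sym] gen by blast
  ultimately show False using inf finite_surj by blast
qed

end

section \<open>Application to the geodesic skeleton\<close>

text \<open>Factors of length one already force every letter into \<open>S\<close>.\<close>

lemma geodesic_skeleton_eq: "geodesic_skeleton G S = skeleton (geodesics G S)"
proof -
  have "x i \<in> S" if "\<And>i n. factor_at x i n \<in> geodesics G S" for x i
    using that[of i 1] by (simp add: factor_at_def geodesics_def)
  then show ?thesis unfolding geodesic_skeleton_def skeleton_def by blast
qed

theorem lemma7p8:
  fixes G :: "('a, 'b) monoid_scheme" and S :: "'a set"
  assumes "group G"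
    and "infinite (carrier G)"
    and "finite S"
    and "S \<subseteq> carrier G"
    and "m_inv G ` S = S"
    and "one G \<notin> S"
    and "generate G S = carrier G"
  shows "topological_entropy (geodesic_skeleton G S) = ln (geodesic_connective_constant G S)"
proof -
  interpret group G by fact
  interpret factorial_language S "geodesics G S"
  proof
    show "geodesics G S \<subseteq> lists S" by (auto simp: geodesics_def)
    show "finite S" by fact
    show "w \<in> geodesics G S" if "u @ w @ v \<in> geodesics G S" for u w v
      using assms(4) that by (rule geodesics_factor_closed)
    show "\<exists>w\<in>geodesics G S. length w = n" for n
      using assms(2-5,7) by (rule geodesic_of_length)
  qed
  show ?thesis
    unfolding geodesic_skeleton_eq geodesic_connective_constant_def geodesic_growth_def
    by (rule entropy_eq_growth_rate)
qed

end
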